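(* Let $n\geq 2$. Define linear maps on operators on $(\mathbb{C}^2)^{\otimes n}$ by $$\phi=\sum_A(\tilde\sigma_x^A\circ T_A)\otimes I_{\bar A},\qquad \eta=\phi+(2^{n-1}-2)\,\mathrm{Diag}\circ\phi ,$$ and let $\mathcal{X}_n$ be the projection onto the span of the matrix units $|i\rangle\langle j|$ with $i,j\in\{0,1\}^n$ and $j=i$ or $j=\bar i$, where $\bar i$ is the bitwise complement of $i$. Then $\eta\circ\mathcal{X}_n[\rho]\geq 0$ for all $n$-qubit biseparable states $\rho$.
   Context: The sum over $A$ is over the $2^{n-1}-1$ partitions of $\{1,\dots,n\}$ into two non-empty parts $\{A,\bar A\}$, each bipartition being counted once, with one (arbitrarily chosen and fixed) of its two parts called $A$. $T_A$ is the transposition on operators on $(\mathbb{C}^2)^{\otimes A}$ in the computational basis, $I_{\bar A}$ is the identity map on operators on the complementary subsystems, and $\tilde\sigma_x^A[X]=\sigma_x^{\otimes A}X\,\sigma_x^{\otimes A}$, with $\sigma_x=\begin{pmatrix}0&1\\1&0\end{pmatrix}$ acting on each qubit in $A$. $\mathrm{Diag}[X]$ is the diagonal matrix with the same diagonal entries as $X$ in the computational basis. The projection $\mathcal{X}_n$ keeps the matrix entries $\langle i|X|j\rangle$ with $j\in\{i,\bar i\}$ and sets all other entries to $0$; equivalently the subspace is $\mathrm{span}\{|i\rangle\langle j| : \langle i|\,G\,|j\rangle\neq 0\}$ with $G=\sum_{C\in\{0,1\}^{n-1}}X^C|\mathrm{GHZ}_n\rangle\langle\mathrm{GHZ}_n|(X^C)^\dagger$,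 $X^C=\mathbb{1}\otimes\sigma_x^{C_2}\otimes\cdots\otimes\sigma_x^{C_n}$, $|\mathrm{GHZ}_n\rangle=\frac{1}{\sqrt2}(|0\cdots0\rangle+|1\cdots1\rangle)$. "$\geq 0$" means positive semidefinite. A state is a positive semidefinite operator of trace one; an $n$-qubit state is biseparable if it is a finite convex combination of states, each of which is a product state $\rho_A\otimes\rho_{\bar A}$ with respect to some bipartition $A|\bar A$ of $\{1,\dots,n\}$ into two non-empty parts (different terms may use different bipartitions). *)

theory Defs
  imports Complex_Main "HOL-Library.FuncSet" "HOL-Library.Nonpos_Ints"
begin

text \<open>
  For a finite set \<open>S\<close> of qubit labels, \<open>bits S\<close> indexes the computational basis of
  \<open>(\<complex>\<^sup>2)\<close> tensored over \<open>S\<close>. An operator on that space is given by its matrix entries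
  \<open>X i j\<close> = \<open>\<langle>i|X|j\<rangle>\<close> for \<open>i, j \<in> bits S\<close>; values at other arguments are irrelevant, and
  equality of operators on \<open>S\<close> is equality of these entries (\<open>op_eq\<close>). Explicit
  carriers are used because operators on arbitrary subsets of the qubits are needed.
\<close>

type_synonym 'q qop = "('q \<Rightarrow> bool) \<Rightarrow> ('q \<Rightarrow> bool) \<Rightarrow> complex"

definition bits :: "'q set \<Rightarrow> ('q \<Rightarrow> bool) set" where
  "bits S = S \<rightarrow>\<^sub>E (UNIV :: bool set)"

definition op_eq :: "'q set \<Rightarrow> 'q qop \<Rightarrow> 'q qop \<Rightarrow> bool" where
  "op_eq S X Y \<longleftrightarrow> (\<forall>i\<in>bits S. \<forall>j\<in>bits S. X i j = Y i j)"

definition op_mult :: "'q set \<Rightarrow> 'q qop \<Rightarrow> 'q qop \<Rightarrow> 'q qop" where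
  "op_mult S X Y = (\<lambda>i j. \<Sum>k\<in>bits S. X i k * Y k j)"

definition op_trace :: "'q set \<Rightarrow> 'q qop \<Rightarrow> complex" where
  "op_trace S X = (\<Sum>i\<in>bits S. X i i)"

definition psd :: "'q set \<Rightarrow> 'q qop \<Rightarrow> bool" where
  "psd S X \<longleftrightarrow>
     (\<forall>v :: ('q \<Rightarrow> bool) \<Rightarrow> complex.
        (\<Sum>i\<in>bits S. \<Sum>j\<in>bits S. cnj (v i) * X i j * v j) \<in> \<real>\<^sub>\<ge>\<^sub>0)"

definition is_state :: "'q set \<Rightarrow> 'q qop \<Rightarrow> bool" where
  "is_state S \<rho> \<longleftrightarrow> psd S \<rho> \<and> op_trace S \<rho> = 1"

text \<open>Tensor product of an operator on \<open>A\<close> and an operator on \<open>B\<close>, for disjoint \<open>A\<close> and \<open>B\<close>.\<close>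

definition op_tensor :: "'q set \<Rightarrow> 'q set \<Rightarrow> 'q qop \<Rightarrow> 'q qop \<Rightarrow> 'q qop" where
  "op_tensor A B X Y =
     (\<lambda>i j. X (restrict i A) (restrict j A) * Y (restrict i B) (restrict j B))"

definition biproduct_state :: "'q set \<Rightarrow> 'q qop \<Rightarrow> bool" where
  "biproduct_state S \<rho> \<longleftrightarrow>
     (\<exists>A \<rho>\<^sub>1 \<rho>\<^sub>2. A \<noteq> {} \<and> A \<subset> S \<and> is_state A \<rho>\<^sub>1 \<and> is_state (S - A) \<rho>\<^sub>2 \<and>
        op_eq S \<rho> (op_tensor A (S - A) \<rho>\<^sub>1 \<rho>\<^sub>2))"

definition biseparable :: "'q set \<Rightarrow> 'q qop \<Rightarrow> bool" where
  "biseparable S \<rho> \<longleftrightarrow> is_state S \<rho> \<and>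
     (\<exists>(m :: nat) (p :: nat \<Rightarrow> real) (\<tau> :: nat \<Rightarrow> 'q qop).
        (\<forall>k<m. p k \<ge> 0) \<and> (\<Sum>k<m. p k) = 1 \<and>
        (\<forall>k<m. is_state S (\<tau> k) \<and> biproduct_state S (\<tau> k)) \<and>
        op_eq S \<rho> (\<lambda>i j. \<Sum>k<m. of_real (p k) * \<tau> k i j))"

text \<open>
  \<open>P\<close> contains exactly one part of every bipartition of \<open>S\<close> into two non-empty parts, so
  a sum over \<open>A \<in> P\<close> counts every bipartition once, for the choice of parts made by \<open>P\<close>.
\<close>

definition bipartition_choice :: "'q set \<Rightarrow> 'q set set \<Rightarrow> bool" where
  "bipartition_choice S P \<longleftrightarrow>
     P \<subseteq> {A. A \<noteq> {} \<and> A \<subset> S} \<and>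
     (\<forall>A. A \<noteq> {} \<and> A \<subset> S \<longrightarrow> (A \<in> P \<longleftrightarrow> S - A \<notin> P))"

definition sigma_x :: "bool \<Rightarrow> bool \<Rightarrow> complex" where
  "sigma_x a b = (if a = b then 0 else 1)"

definition sigma_x_tensor :: "'q set \<Rightarrow> 'q qop" where
  "sigma_x_tensor A = (\<lambda>i j. \<Prod>k\<in>A. sigma_x (i k) (j k))"

definition sigma_x_conj :: "'q set \<Rightarrow> 'q qop \<Rightarrow> 'q qop" where
  "sigma_x_conj A X = op_mult A (op_mult A (sigma_x_tensor A) X) (sigma_x_tensor A)"

definition op_transpose :: "'q qop \<Rightarrow> 'q qop" where
  "op_transpose X = (\<lambda>i j. X j i)"

text \<open>
  \<open>map_tensor_id A F\<close> is the tensor product of a linear map \<open>F\<close> on operators on \<open>A\<close> with the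
  identity map on operators on the remaining qubits: for fixed row and column indices
  outside \<open>A\<close>, the map \<open>F\<close> acts on the corresponding block of \<open>X\<close>, an operator on \<open>A\<close>.
\<close>

definition map_tensor_id :: "'q set \<Rightarrow> ('q qop \<Rightarrow> 'q qop) \<Rightarrow> 'q qop \<Rightarrow> 'q qop" where
  "map_tensor_id A F X =
     (\<lambda>i j. F (\<lambda>a b. X (override_on i a A) (override_on j b A)) (restrict i A) (restrict j A))"

definition op_diag :: "'q qop \<Rightarrow> 'q qop" where
  "op_diag X = (\<lambda>i j. if i = j then X i j else 0)"

definition phi :: "'q set set \<Rightarrow> 'q qop \<Rightarrow> 'q qop" where
  "phi P X = (\<lambda>i j. \<Sum>A\<in>P. map_tensor_id A (sigma_x_conj A \<circ> op_transpose) X i j)"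

definition eta :: "nat \<Rightarrow> nat set set \<Rightarrow> nat qop \<Rightarrow> nat qop" where
  "eta n P X = (\<lambda>i j. phi P X i j + (2 ^ (n - 1) - 2) * (op_diag \<circ> phi P) X i j)"

definition bit_compl :: "'q set \<Rightarrow> ('q \<Rightarrow> bool) \<Rightarrow> ('q \<Rightarrow> bool)" where
  "bit_compl S i = (\<lambda>k\<in>S. \<not> i k)"

definition X_proj :: "nat \<Rightarrow> nat qop \<Rightarrow> nat qop" where
  "X_proj n X = (\<lambda>i j. if j = i \<or> j = bit_compl {1..n} i then X i j else 0)"

end

theory Submission
  imports Defs
begin

text \<open>
  Write \<open>flip A i\<close> for the basis index \<open>i\<close> with the bits in \<open>A\<close> negated. On a matrix supported on
  the diagonal and the antidiagonal, each summand of \<open>\<phi>\<close> fixes the antidiagonal entries and moves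
  the diagonal entry at \<open>flip A i\<close> to position \<open>i\<close>. Since there are \<open>2\<^sup>n\<^sup>-\<^sup>1 - 1\<close> summands, the output
  of \<open>\<eta>\<close> is \<open>2\<^sup>n\<^sup>-\<^sup>1 - 1\<close> times the matrix with the entries of \<open>\<rho>\<close> on the antidiagonal and the sums of
  \<open>\<rho> (flip A i) (flip A i)\<close> over \<open>A\<close> on the diagonal. By linearity \<open>\<rho>\<close> may be taken to be a product
  state over some \<open>A | B\<close>. Multiplying the \<open>2 \<times> 2\<close> minor inequalities of its two factors bounds
  the squared modulus of the antidiagonal entry at \<open>i\<close> by the product of the diagonal entries at
  \<open>flip A i\<close> and \<open>flip B i\<close>. If \<open>A\<close> is the chosen part, the first is a summand of the new diagonal entry
  at \<open>i\<close>, and the second one of the new diagonal entry at the complement of \<open>i\<close>.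
\<close>

section \<open>Basis indices and bit flips\<close>

text \<open>Unlike \<open>bit_compl A\<close>, which is \<open>undefined\<close> off
  \<open>A\<close>, this keeps the other bits, so an index of a larger set stays one.\<close>

definition flip :: "'q set \<Rightarrow> ('q \<Rightarrow> bool) \<Rightarrow> ('q \<Rightarrow> bool)" where
  "flip A i = (\<lambda>k. if k \<in> A then \<not> i k else i k)"

lemma finite_bits: "finite S \<Longrightarrow> finite (bits S)"
  unfolding bits_def by (intro finite_PiE) auto

lemma bit_compl_in_bits [simp]: "bit_compl S i \<in> bits S"
  by (auto simp: bits_def bit_compl_def)

lemma restrict_in_bits [simp]: "restrict i S \<in> bits S"
  by (auto simp: bits_def)

lemma bits_ext: "i \<in> bits S \<Longrightarrow> j \<in> bits S \<Longrightarrow> (\<And>k. k \<in> S \<Longrightarrow> i k = j k) \<Longrightarrow> i = j"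
  unfolding bits_def by (rule PiE_ext)

lemma bit_compl_involutive [simp]: "i \<in> bits S \<Longrightarrow> bit_compl S (bit_compl S i) = i"
  by (rule bits_ext) (auto simp: bit_compl_def)

lemma bit_compl_neq: "S \<noteq> {} \<Longrightarrow> bit_compl S i \<noteq> i"
  by (auto simp: bit_compl_def fun_eq_iff restrict_def split: if_splits)

lemma bit_compl_restrict [simp]: "bit_compl A (restrict i A) = bit_compl A i"
  by (auto simp: bit_compl_def fun_eq_iff)

lemma bij_betw_bit_compl: "bij_betw (bit_compl S) (bits S) (bits S)"
  by (rule bij_betw_byWitness[where f' = "bit_compl S"]) auto

lemma flip_in_bits: "A \<subseteq> S \<Longrightarrow> i \<in> bits S \<Longrightarrow> flip A i \<in> bits S"
  by (auto simp: bits_def flip_def PiE_def extensional_def)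

text \<open>On \<open>A\<close> the two negations cancel. Hence diagonal entries for the part that
  was not chosen appear as entries for the chosen part at the complementary index.\<close>

lemma flip_bit_compl:
  "A \<subseteq> S \<Longrightarrow> i \<in> bits S \<Longrightarrow> flip A (bit_compl S i) = flip (S - A) i"
  by (rule bits_ext[where S = S]) (auto simp: flip_in_bits, auto simp: flip_def bit_compl_def)

section \<open>Positive semidefinite matrices\<close>

lemma psd_cong: "op_eq S X Y \<Longrightarrow> psd S X \<longleftrightarrow> psd S Y"
  unfolding psd_def op_eq_def by (simp cong: sum.cong)

lemma psd_scale:
  assumes "c \<ge> 0" "psd S X"
  shows "psd S (\<lambda>i j. of_real c * X i j)"
  unfolding psd_def
proof
  fix v :: "('a \<Rightarrow> bool) \<Rightarrow> complex"
  have "(\<Sum>i\<in>bits S. \<Sum>j\<in>bits S. cnj (v i) * (of_real c * X i j) * v j) =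
      of_real c * (\<Sum>i\<in>bits S. \<Sum>j\<in>bits S. cnj (v i) * X i j * v j)"
    by (simp add: sum_distrib_left mult_ac)
  also have "\<dots> \<in> \<real>\<^sub>\<ge>\<^sub>0"
    using assms by (intro nonneg_Reals_mult_I) (auto simp: psd_def)
  finally show "(\<Sum>i\<in>bits S. \<Sum>j\<in>bits S. cnj (v i) * (of_real c * X i j) * v j) \<in> \<real>\<^sub>\<ge>\<^sub>0" .
qed

lemma psd_zero: "psd S (\<lambda>i j. 0)"
  by (simp add: psd_def)

lemma psd_add: "psd S X \<Longrightarrow> psd S Y \<Longrightarrow> psd S (\<lambda>i j. X i j + Y i j)"
  by (simp add: psd_def algebra_simps sum.distrib nonneg_Reals_add_I)

lemma psd_sum:
  assumes "\<And>k. k \<in> K \<Longrightarrow> psd S (X k)"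
  shows "psd S (\<lambda>i j. \<Sum>k\<in>K. X k i j)"
  using assms by (induction K rule: infinite_finite_induct) (auto intro: psd_zero psd_add)

text \<open>Evaluates the quadratic form at a vector supported on two basis indices. Hermiticity and
  the minor inequality both come from suitable \<open>a\<close> and \<open>b\<close>.\<close>

lemma psd_two_point:
  assumes "finite S" "psd S X" "i \<in> bits S" "j \<in> bits S" "i \<noteq> j"
  shows "cnj a * X i i * a + cnj a * X i j * b + cnj b * X j i * a + cnj b * X j j * b \<in> \<real>\<^sub>\<ge>\<^sub>0"
proof -
  define v where "v = (\<lambda>k. if k = i then a else if k = j then b else 0)"
  have "(\<Sum>k\<in>bits S. g k) = (\<Sum>k\<in>{i, j}. g k)" if "\<And>k. k \<noteq> i \<Longrightarrow> k \<noteq> j \<Longrightarrow> g k = 0"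
    for g :: "_ \<Rightarrow> complex"
    using assms that by (intro sum.mono_neutral_right) (auto simp: finite_bits)
  hence *: "(\<Sum>k\<in>bits S. g k) = g i + g j" if "\<And>k. k \<noteq> i \<Longrightarrow> k \<noteq> j \<Longrightarrow> g k = 0"
    for g :: "_ \<Rightarrow> complex"
    using that assms(5) by simp
  have "(\<Sum>k\<in>bits S. \<Sum>l\<in>bits S. cnj (v k) * X k l * v l) =
      (\<Sum>k\<in>bits S. cnj (v k) * X k i * v i + cnj (v k) * X k j * v j)"
    by (intro sum.cong refl *) (simp add: v_def)
  also have "\<dots> = cnj (v i) * X i i * v i + cnj (v i) * X i j * v j
      + (cnj (v j) * X j i * v i + cnj (v j) * X j j * v j)"
    by (rule *) (simp add: v_def)
  also have "\<dots> = cnj a * X i i * a + cnj a * X i j * b + cnj b * X j i * a + cnj b * X j j * b"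
    using assms(5) by (simp add: v_def)
  finally have eq: "(\<Sum>k\<in>bits S. \<Sum>l\<in>bits S. cnj (v k) * X k l * v l) =
      cnj a * X i i * a + cnj a * X i j * b + cnj b * X j i * a + cnj b * X j j * b" .
  show ?thesis
    using assms(2)[unfolded psd_def, rule_format, of v] unfolding eq .
qed

lemma psd_diag:
  assumes "finite S" "psd S X" "i \<in> bits S"
  shows "X i i \<in> \<real>\<^sub>\<ge>\<^sub>0"
proof -
  define v where "v = (\<lambda>k. if k = i then 1 else 0 :: complex)"
  have "(\<Sum>k\<in>bits S. \<Sum>l\<in>bits S. cnj (v k) * X k l * v l) =
      (\<Sum>k\<in>bits S. \<Sum>l\<in>bits S. if l = i then (if k = i then X k l else 0) else 0)"
    by (intro sum.cong refl) (auto simp: v_def)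
  also have "\<dots> = X i i"
    using assms by (simp add: finite_bits)
  finally have eq: "(\<Sum>k\<in>bits S. \<Sum>l\<in>bits S. cnj (v k) * X k l * v l) = X i i" .
  show ?thesis
    using assms(2)[unfolded psd_def, rule_format, of v] unfolding eq .
qed

text \<open>Polarization: \<open>psd\<close> only says that the form takes nonnegative real values.
  Its reality at (1, 1) and (1, \<i>) compares the imaginary and the real parts of the two
  off-diagonal entries.\<close>

lemma psd_hermitian:
  assumes "finite S" "psd S X" "i \<in> bits S" "j \<in> bits S"
  shows "X j i = cnj (X i j)"
proof (cases "i = j")
  case True
  with psd_diag[OF assms(1-3)] show ?thesis
    by (auto simp: complex_nonneg_Reals_iff complex_eq_iff)
next
  case False
  have d: "Im (X i i) = 0" "Im (X j j) = 0"
    using psd_diag[OF assms(1,2)] assms(3,4) by (auto simp: complex_nonneg_Reals_iff)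
  show ?thesis
    using psd_two_point[OF assms False, of 1 1] psd_two_point[OF assms False, of 1 \<i>] d
    by (auto simp: complex_nonneg_Reals_iff complex_eq_iff)
qed

lemma psd_minor:
  assumes "finite S" "psd S X" "i \<in> bits S" "j \<in> bits S"
  shows "(cmod (X i j))\<^sup>2 \<le> Re (X i i) * Re (X j j)"
proof (cases "i = j")
  case True
  with psd_diag[OF assms(1-3)] show ?thesis
    by (auto simp: complex_nonneg_Reals_iff cmod_def power2_eq_square)
next
  case False
  define p q z where "p = Re (X i i)" and "q = Re (X j j)" and "z = X i j"
  have X: "X i i = of_real p" "X j j = of_real q" "X j i = cnj z" and "p \<ge> 0"
    using psd_diag[OF assms(1,2)] psd_hermitian[OF assms] assms(3,4)
    by (auto simp: complex_nonneg_Reals_iff complex_eq_iff p_def q_def z_def)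
  \<comment> \<open>The test vector is -tz at \<open>i\<close> and 1 at \<open>j\<close>. The phase
    of z cancels, which leaves a real polynomial in t of degree at most two.\<close>
  have *: "0 \<le> t\<^sup>2 * (cmod z)\<^sup>2 * p - 2 * t * (cmod z)\<^sup>2 + q" for t :: real
  proof -
    have "cnj (- (of_real t * z)) * X i i * (- (of_real t * z)) + cnj (- (of_real t * z)) * X i j * 1
        + cnj 1 * X j i * (- (of_real t * z)) + cnj 1 * X j j * 1
      = of_real t ^ 2 * (z * cnj z) * of_real p - 2 * of_real t * (z * cnj z) + of_real q"
      unfolding X z_def[symmetric] by (simp add: power2_eq_square algebra_simps)
    also have "\<dots> = of_real (t\<^sup>2 * (cmod z)\<^sup>2 * p - 2 * t * (cmod z)\<^sup>2 + q)"
      by (simp add: complex_norm_square[symmetric])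
    finally have "complex_of_real (t\<^sup>2 * (cmod z)\<^sup>2 * p - 2 * t * (cmod z)\<^sup>2 + q) \<in> \<real>\<^sub>\<ge>\<^sub>0"
      using psd_two_point[OF assms False, of "- (of_real t * z)" 1] by metis
    thus ?thesis
      by (simp only: nonneg_Reals_of_real_iff)
  qed
  show ?thesis
  proof (cases "p = 0")
    case True
    have "(cmod z)\<^sup>2 = 0"
    proof (rule ccontr)
      assume "(cmod z)\<^sup>2 \<noteq> 0"
      \<comment> \<open>For p = 0 the polynomial is q - 2t|z|^2, which equals -1 at this t.\<close>
      thus False
        using *[of "(q + 1) / (2 * (cmod z)\<^sup>2)"] True by (simp add: field_simps)
    qed
    thus ?thesis using True by (simp add: p_def z_def)
  next
    case False
    with \<open>p \<ge> 0\<close> have "p > 0" by simp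
    \<comment> \<open>The polynomial is minimal at t = 1/p.\<close>
    have "(cmod z)\<^sup>2 \<le> p * q"
      using *[of "1 / p"] \<open>p > 0\<close> by (simp add: field_simps power2_eq_square)
    thus ?thesis by (simp add: p_def q_def z_def)
  qed
qed

text \<open>Each pair of complementary indices spans a Hermitian 2x2 block with nonnegative diagonal
  and determinant. Instead of choosing representatives of the pairs, the proof sums over all indices
  and reindexes by complementation.\<close>

lemma psd_X_form:
  fixes D :: "('q \<Rightarrow> bool) \<Rightarrow> real" and w :: "('q \<Rightarrow> bool) \<Rightarrow> complex"
  assumes "finite S" "S \<noteq> {}"
    and D: "\<And>i. i \<in> bits S \<Longrightarrow> D i \<ge> 0"
    and w: "\<And>i. i \<in> bits S \<Longrightarrow> w (bit_compl S i) = cnj (w i)"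
    and minor: "\<And>i. i \<in> bits S \<Longrightarrow> (cmod (w i))\<^sup>2 \<le> D i * D (bit_compl S i)"
  shows "psd S (\<lambda>i j. if i = j then of_real (D i) else if j = bit_compl S i then w i else 0)"
  unfolding psd_def
proof
  fix v :: "('q \<Rightarrow> bool) \<Rightarrow> complex"
  let ?Y = "\<lambda>i j. if i = j then of_real (D i) else if j = bit_compl S i then w i else 0"
  let ?c = "bit_compl S"
  define T where "T = (\<Sum>i\<in>bits S. cnj (v i) * w i * v (?c i))"
  \<comment> \<open>With these weights the diagonal part of the form is the sum of the squares of
    \<open>x\<close>, so it suffices that \<open>T\<close>, the antidiagonal part, is real and
    bounded in modulus by that sum.\<close>
  define x where "x = (\<lambda>i. cmod (v i) * sqrt (D i))"
  have reindex: "(\<Sum>i\<in>bits S. g (?c i)) = (\<Sum>i\<in>bits S. g i)" for g :: "_ \<Rightarrow> 'c::comm_monoid_add"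
    by (rule sum.reindex_bij_betw[OF bij_betw_bit_compl])
  have "(\<Sum>j\<in>bits S. cnj (v i) * ?Y i j * v j) =
      of_real ((x i)\<^sup>2) + cnj (v i) * w i * v (?c i)" if i: "i \<in> bits S" for i
  proof -
    have "(\<Sum>j\<in>bits S. cnj (v i) * ?Y i j * v j) = (\<Sum>j\<in>{i, ?c i}. cnj (v i) * ?Y i j * v j)"
      using i assms(1) by (intro sum.mono_neutral_right) (auto simp: finite_bits)
    also have "\<dots> = cnj (v i) * of_real (D i) * v i + cnj (v i) * w i * v (?c i)"
      using bit_compl_neq[OF assms(2), of i] by (subst sum.insert) auto
    also have "cnj (v i) * of_real (D i) * v i = of_real ((x i)\<^sup>2)"
      using D[OF i] complex_norm_square[of "v i"] by (simp add: x_def power_mult_distrib mult_ac)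
    finally show ?thesis .
  qed
  hence form: "(\<Sum>i\<in>bits S. \<Sum>j\<in>bits S. cnj (v i) * ?Y i j * v j) =
      of_real (\<Sum>i\<in>bits S. (x i)\<^sup>2) + T"
    by (simp add: sum.distrib T_def)
  \<comment> \<open>Conjugation exchanges the terms of \<open>T\<close> at an index and at its
    complement.\<close>
  have "cnj T = (\<Sum>i\<in>bits S. cnj (v (?c i)) * w (?c i) * v (?c (?c i)))"
    unfolding T_def by (simp add: w mult_ac)
  also have "\<dots> = T"
    unfolding T_def by (rule reindex)
  finally have "Im T = 0"
    by (simp add: complex_eq_iff)
  have "cmod (w i) \<le> sqrt (D i) * sqrt (D (?c i))" if "i \<in> bits S" for i
    using minor[OF that] by (simp add: real_le_rsqrt flip: real_sqrt_mult)
  hence "cmod (cnj (v i) * w i * v (?c i)) \<le> x i * x (?c i)" if "i \<in> bits S" for i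
    using mult_left_mono[of "cmod (w i)" "sqrt (D i) * sqrt (D (?c i))" "cmod (v i) * cmod (v (?c i))"]
      that by (simp add: x_def norm_mult mult_ac)
  \<comment> \<open>Arithmetic-geometric mean; after summation both halves agree by
    reindexing.\<close>
  moreover have "x i * x (?c i) \<le> ((x i)\<^sup>2 + (x (?c i))\<^sup>2) / 2" for i
    using sum_squares_bound[of "x i" "x (?c i)"] by simp
  ultimately have "cmod T \<le> (\<Sum>i\<in>bits S. ((x i)\<^sup>2 + (x (?c i))\<^sup>2) / 2)"
    unfolding T_def by (intro sum_norm_le) (meson order_trans)
  also have "\<dots> = (\<Sum>i\<in>bits S. (x i)\<^sup>2)"
    by (simp add: sum.distrib reindex[of "\<lambda>i. (x i)\<^sup>2"] flip: sum_divide_distrib)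
  finally have "Re T \<ge> - (\<Sum>i\<in>bits S. (x i)\<^sup>2)"
    using abs_Re_le_cmod[of T] by linarith
  thus "(\<Sum>i\<in>bits S. \<Sum>j\<in>bits S. cnj (v i) * ?Y i j * v j) \<in> \<real>\<^sub>\<ge>\<^sub>0"
    unfolding form using \<open>Im T = 0\<close> by (simp add: complex_nonneg_Reals_iff del: of_real_sum)
qed

section \<open>The entries of the output of the map\<close>

lemma sigma_x_tensor_eq:
  assumes "finite A" "i \<in> bits A" "j \<in> bits A"
  shows "sigma_x_tensor A i j = (if j = bit_compl A i then 1 else 0)"
proof (cases "\<forall>k\<in>A. i k \<noteq> j k")
  case True
  hence "j = bit_compl A i"
    using assms by (intro bits_ext[where S = A]) (auto simp: bit_compl_def)
  thus ?thesis
    using True by (simp add: sigma_x_tensor_def sigma_x_def)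
next
  case False
  hence "j \<noteq> bit_compl A i"
    by (auto simp: bit_compl_def)
  moreover have "sigma_x_tensor A i j = 0"
    using False assms(1) by (auto simp: sigma_x_tensor_def sigma_x_def prod_zero_iff)
  ultimately show ?thesis by simp
qed

lemma sigma_x_conj_eq:
  assumes "finite A" "i \<in> bits A" "j \<in> bits A"
  shows "sigma_x_conj A X i j = X (bit_compl A i) (bit_compl A j)"
proof -
  have row: "op_mult A (sigma_x_tensor A) X i k = X (bit_compl A i) k" for k
  proof -
    have "op_mult A (sigma_x_tensor A) X i k =
        (\<Sum>l\<in>bits A. if l = bit_compl A i then X l k else 0)"
      unfolding op_mult_def using assms by (intro sum.cong) (auto simp: sigma_x_tensor_eq)
    thus ?thesis using assms by (simp add: finite_bits)
  qed
  have "sigma_x_conj A X i j = (\<Sum>k\<in>bits A. X (bit_compl A i) k * sigma_x_tensor A k j)"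
    unfolding sigma_x_conj_def by (subst op_mult_def) (simp add: row)
  also have "\<dots> = (\<Sum>k\<in>bits A. if k = bit_compl A j then X (bit_compl A i) k else 0)"
    using assms by (intro sum.cong) (auto simp: sigma_x_tensor_eq)
  finally show ?thesis using assms by (simp add: finite_bits)
qed

text \<open>Transposition swaps the \<open>A\<close>-parts of the row and column indices and
  conjugation complements them, hence the crossing of \<open>i\<close> and \<open>j\<close>.\<close>

lemma map_tensor_sigma_x_transpose_eq:
  assumes "finite A"
  shows "map_tensor_id A (sigma_x_conj A \<circ> op_transpose) X i j =
    X (override_on i (bit_compl A j) A) (override_on j (bit_compl A i) A)"
  using assms by (simp add: map_tensor_id_def sigma_x_conj_eq op_transpose_def)

text \<open>The index change preserves and reflects both relations, being equal and being
  complementary, so the support is unchanged. On a complementary pair it is the identity, because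
  complementing the \<open>A\<close>-part of \<open>j\<close> gives back that of \<open>i\<close>;
  on an equal pair it flips \<open>A\<close>.\<close>

lemma map_tensor_X_proj_eq:
  assumes A: "A \<subseteq> {1..n}" and "n \<ge> 1" and i: "i \<in> bits {1..n}" and j: "j \<in> bits {1..n}"
  shows "map_tensor_id A (sigma_x_conj A \<circ> op_transpose) (X_proj n X) i j =
    (if i = j then X (flip A i) (flip A i) else if j = bit_compl {1..n} i then X i j else 0)"
proof -
  let ?S = "{1..n}"
  let ?i = "override_on i (bit_compl A j) A" and ?j = "override_on j (bit_compl A i) A"
  have fin: "finite A" using A by (rule finite_subset) simp
  have bits: "?i \<in> bits ?S" "?j \<in> bits ?S"
    using A i j by (auto simp: bits_def PiE_def extensional_def override_on_def)
  have eq: "?j = ?i \<longleftrightarrow> i = j"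
  proof
    assume "?j = ?i"
    hence e: "?j k = ?i k" for k by simp
    show "i = j"
    proof
      fix k show "i k = j k"
        using e[of k] by (cases "k \<in> A") (auto simp: override_on_def bit_compl_def)
    qed
  qed simp
  have compl: "?j = bit_compl ?S ?i \<longleftrightarrow> j = bit_compl ?S i"
  proof
    assume "?j = bit_compl ?S ?i"
    hence e: "?j k = bit_compl ?S ?i k" for k by simp
    show "j = bit_compl ?S i"
    proof (rule bits_ext[OF j bit_compl_in_bits])
      fix k assume k: "k \<in> ?S"
      show "j k = bit_compl ?S i k"
        using e[of k] k by (cases "k \<in> A") (auto simp: override_on_def bit_compl_def)
    qed
  next
    assume "j = bit_compl ?S i"
    thus "?j = bit_compl ?S ?i"
      using A bits by (intro bits_ext[where S = ?S]) (auto simp: override_on_def bit_compl_def)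
  qed
  have diag: "?i = flip A i" if "i = j"
    using that by (auto simp: override_on_def flip_def bit_compl_def fun_eq_iff)
  have anti: "?i = i" "?j = j" if "j = bit_compl ?S i"
    using that A by (auto simp: override_on_def bit_compl_def fun_eq_iff)
  show ?thesis
    unfolding map_tensor_sigma_x_transpose_eq[OF fin]
    using eq compl diag anti by (auto simp: X_proj_def)
qed

text \<open>The power set is the disjoint union of \<open>P\<close>, the complements of its members,
  and the two distinct sets {} and \<open>S\<close>. Stating it with a sum avoids subtraction on
  naturals.\<close>

lemma card_bipartition_choice:
  assumes "finite S" "S \<noteq> {}" "bipartition_choice S P"
  shows "2 * (card P + 1) = 2 ^ card S"
proof -
  have P: "P \<subseteq> {A. A \<noteq> {} \<and> A \<subset> S}"
    and ch: "\<And>A. A \<noteq> {} \<Longrightarrow> A \<subset> S \<Longrightarrow> A \<in> P \<longleftrightarrow> S - A \<notin> P"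
    using assms(3) by (auto simp: bipartition_choice_def)
  let ?Q = "(\<lambda>A. S - A) ` P"
  have dd: "S - (S - A) = A" if "A \<in> P" for A using P that by auto
  have fin: "finite P"
    by (rule finite_subset[of _ "Pow S"]) (use P assms(1) in auto)
  have "card ?Q = card P"
    by (intro card_image inj_on_inverseI[where g = "\<lambda>A. S - A"] dd)
  moreover have disj: "P \<inter> ?Q = {}"
  proof -
    have "S - A \<notin> P" if "A \<in> P" for A
      using ch[of A] that P by auto
    thus ?thesis by auto
  qed
  moreover have "Pow S = (P \<union> ?Q) \<union> {{}, S}"
  proof
    show "Pow S \<subseteq> (P \<union> ?Q) \<union> {{}, S}"
    proof
      fix A assume "A \<in> Pow S"
      show "A \<in> (P \<union> ?Q) \<union> {{}, S}"
      proof (cases "A = {} \<or> A = S \<or> A \<in> P")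
        case False
        with \<open>A \<in> Pow S\<close> ch[of A] have "S - A \<in> P" by auto
        moreover have "A = S - (S - A)" using \<open>A \<in> Pow S\<close> by auto
        ultimately show ?thesis by blast
      qed auto
    qed
    show "(P \<union> ?Q) \<union> {{}, S} \<subseteq> Pow S" using P by auto
  qed
  moreover have "(P \<union> ?Q) \<inter> {{}, S} = {}"
    using P by auto
  ultimately have "card (Pow S) = card P + card P + card {{}, S}"
    using fin by (simp only: card_Un_disjoint finite_Un finite_imageI finite.intros)
  thus ?thesis
    using assms by (simp add: card_Pow)
qed

text \<open>An antidiagonal entry is kept by every summand of \<open>phi\<close>, so it is
  multiplied by \<open>card P\<close>. The coefficient of the diagonal term in \<open>eta\<close>
  gives the diagonal the same factor, which can then be pulled out.\<close>

lemma eta_X_proj_eq: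
  assumes n: "n \<ge> 1" and P: "bipartition_choice {1..n} P"
    and i: "i \<in> bits {1..n}" and j: "j \<in> bits {1..n}"
  shows "eta n P (X_proj n X) i j = of_real (2 ^ (n - 1) - 1) *
    (if i = j then \<Sum>A\<in>P. X (flip A i) (flip A i)
     else if j = bit_compl {1..n} i then X i j else 0)"
proof -
  have "2 * (card P + 1) = 2 ^ n"
    using card_bipartition_choice[OF _ _ P] n by simp
  also have "(2 :: nat) ^ n = 2 * 2 ^ (n - 1)"
    using n by (cases n) auto
  finally have "card P + 1 = 2 ^ (n - 1)"
    by simp
  hence "of_nat (card P + 1) = (of_nat (2 ^ (n - 1)) :: complex)"
    by (rule arg_cong)
  hence card: "of_nat (card P) = (2 ^ (n - 1) - 1 :: complex)"
    by (simp add: algebra_simps)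
  have "A \<subseteq> {1..n}" if "A \<in> P" for A
    using P that by (auto simp: bipartition_choice_def)
  hence phi: "phi P (X_proj n X) i j = (\<Sum>A\<in>P. if i = j then X (flip A i) (flip A i)
      else if j = bit_compl {1..n} i then X i j else 0)"
    unfolding phi_def by (intro sum.cong refl map_tensor_X_proj_eq n i j)
  have "eta n P (X_proj n X) i j =
      (if i = j then (2 ^ (n - 1) - 1) * phi P (X_proj n X) i j else phi P (X_proj n X) i j)"
    by (simp add: eta_def op_diag_def algebra_simps)
  thus ?thesis
    unfolding phi by (simp add: card)
qed

section \<open>Product states and convex combinations\<close>

text \<open>The minors of \<open>X\<close> and \<open>Y\<close> give four diagonal factors, two per
  tensor factor. Pairing the complemented index on one side with the original index on the other
  regroups them as diagonal entries of \<open>Z\<close>.\<close>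

lemma tensor_antidiagonal_bound:
  assumes S: "finite S" "A \<subseteq> S" and psd: "psd A X" "psd (S - A) Y" and i: "i \<in> bits S"
    and Z: "Z = op_tensor A (S - A) X Y"
  shows "(cmod (Z i (bit_compl S i)))\<^sup>2
    \<le> Re (Z (flip A i) (flip A i)) * Re (Z (flip (S - A) i) (flip (S - A) i))"
proof -
  let ?B = "S - A"
  define a b where "a = restrict i A" and "b = restrict i ?B"
  let ?a = "bit_compl A a" and ?b = "bit_compl ?B b"
  have fin: "finite A" "finite ?B" using S finite_subset by auto
  have ab: "a \<in> bits A" "b \<in> bits ?B" by (auto simp: a_def b_def)
  have r: "restrict (bit_compl S i) A = ?a" "restrict (bit_compl S i) ?B = ?b"
    "restrict (flip A i) A = ?a" "restrict (flip A i) ?B = b"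
    "restrict (flip ?B i) A = a" "restrict (flip ?B i) ?B = ?b"
    using S(2) by (auto simp: a_def b_def flip_def bit_compl_def fun_eq_iff)
  \<comment> \<open>Real parts multiply here because the diagonal entries of \<open>X\<close> are
    real.\<close>
  have re: "Re (X c c * Y d d) = Re (X c c) * Re (Y d d)" if "c \<in> bits A" "d \<in> bits ?B" for c d
    using psd_diag[OF fin(1) psd(1) that(1)] by (simp add: complex_nonneg_Reals_iff)
  have "(cmod (Z i (bit_compl S i)))\<^sup>2 = (cmod (X a ?a))\<^sup>2 * (cmod (Y b ?b))\<^sup>2"
    by (simp add: Z op_tensor_def r norm_mult power_mult_distrib flip: a_def b_def)
  also have "\<dots> \<le> (Re (X a a) * Re (X ?a ?a)) * (Re (Y b b) * Re (Y ?b ?b))"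
    using psd_minor[OF fin(1) psd(1) ab(1) bit_compl_in_bits]
      psd_minor[OF fin(2) psd(2) ab(2) bit_compl_in_bits]
    by (intro mult_mono) (auto intro: order_trans[OF zero_le_power2])
  also have "\<dots> = Re (Z (flip A i) (flip A i)) * Re (Z (flip ?B i) (flip ?B i))"
    using ab by (simp add: Z op_tensor_def r re del: times_complex.sel)
  finally show ?thesis .
qed

lemma psd_eta_X_proj_biproduct:
  assumes n: "n \<ge> 1" and P: "bipartition_choice {1..n} P"
    and st: "is_state {1..n} \<tau>" and bi: "biproduct_state {1..n} \<tau>"
  shows "psd {1..n} (eta n P (X_proj n \<tau>))"
proof -
  let ?S = "{1..n}"
  define D where "D = (\<lambda>i. \<Sum>A\<in>P. Re (\<tau> (flip A i) (flip A i)))"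
  define w where "w = (\<lambda>i. \<tau> i (bit_compl ?S i))"
  have psd: "psd ?S \<tau>" using st by (simp add: is_state_def)
  have PS: "A \<subseteq> ?S" if "A \<in> P" for A
    using P that by (auto simp: bipartition_choice_def)
  have finP: "finite P"
    by (rule finite_subset[of _ "Pow ?S"]) (use PS in auto)
  have nonneg: "\<tau> (flip A i) (flip A i) \<in> \<real>\<^sub>\<ge>\<^sub>0" if "A \<subseteq> ?S" "i \<in> bits ?S" for A i
    by (rule psd_diag[OF _ psd flip_in_bits[OF that]]) simp
  \<comment> \<open>A single summand is at most \<open>D i\<close> because all summands are
    nonnegative.\<close>
  have D_ge: "Re (\<tau> (flip A i) (flip A i)) \<le> D i" if "A \<in> P" "i \<in> bits ?S" for A i
    unfolding D_def using that nonneg PS finP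
    by (intro member_le_sum) (auto simp: complex_nonneg_Reals_iff)
  have D_nonneg: "D i \<ge> 0" if "i \<in> bits ?S" for i
    unfolding D_def using that nonneg PS by (intro sum_nonneg) (auto simp: complex_nonneg_Reals_iff)
  obtain A \<rho>1 \<rho>2 where A: "A \<noteq> {}" "A \<subset> ?S" and fac: "is_state A \<rho>1" "is_state (?S - A) \<rho>2"
    and eq: "op_eq ?S \<tau> (op_tensor A (?S - A) \<rho>1 \<rho>2)"
    using bi unfolding biproduct_state_def by blast
  have bound: "(cmod (w i))\<^sup>2
      \<le> Re (\<tau> (flip A i) (flip A i)) * Re (\<tau> (flip (?S - A) i) (flip (?S - A) i))"
    if i: "i \<in> bits ?S" for i
  proof -
    have "flip A i \<in> bits ?S" "flip (?S - A) i \<in> bits ?S"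
      using A i by (auto intro: flip_in_bits)
    with tensor_antidiagonal_bound[OF _ _ _ _ i refl, of A \<rho>1 \<rho>2] A fac eq i show ?thesis
      by (auto simp: w_def op_eq_def is_state_def psubset_eq)
  qed
  have minor: "(cmod (w i))\<^sup>2 \<le> D i * D (bit_compl ?S i)" if i: "i \<in> bits ?S" for i
  proof -
    \<comment> \<open>The bound is symmetric in \<open>A\<close> and its complement, so it can be
      stated for whichever of them \<open>P\<close> contains.\<close>
    have "\<exists>C\<in>P. C \<subseteq> ?S \<and> (cmod (w i))\<^sup>2
        \<le> Re (\<tau> (flip C i) (flip C i)) * Re (\<tau> (flip (?S - C) i) (flip (?S - C) i))"
    proof (cases "A \<in> P")
      case True
      with bound[OF i] A show ?thesis by blast
    next
      case False
      with P A have "?S - A \<in> P" by (auto simp: bipartition_choice_def)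
      moreover have "?S - (?S - A) = A" using A by auto
      ultimately show ?thesis
        using bound[OF i] by (intro bexI[of _ "?S - A"]) (simp_all add: mult.commute)
    qed
    then obtain C where C: "C \<in> P" "C \<subseteq> ?S" and le: "(cmod (w i))\<^sup>2
        \<le> Re (\<tau> (flip C i) (flip C i)) * Re (\<tau> (flip (?S - C) i) (flip (?S - C) i))"
      by blast
    have "flip (?S - C) i = flip C (bit_compl ?S i)"
      by (rule flip_bit_compl[symmetric, OF C(2) i])
    hence "Re (\<tau> (flip (?S - C) i) (flip (?S - C) i)) \<le> D (bit_compl ?S i)"
      using D_ge[OF C(1), of "bit_compl ?S i"] by simp
    moreover have "0 \<le> Re (\<tau> (flip (?S - C) i) (flip (?S - C) i))"
      using nonneg[of "?S - C" i] i by (simp add: complex_nonneg_Reals_iff)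
    ultimately show ?thesis
      using D_ge[OF C(1) i] D_nonneg[OF i] by (intro order_trans[OF le] mult_mono) auto
  qed
  have "psd ?S (\<lambda>i j. if i = j then of_real (D i) else if j = bit_compl ?S i then w i else 0)"
  proof (rule psd_X_form)
    show "w (bit_compl ?S i) = cnj (w i)" if "i \<in> bits ?S" for i
      using psd_hermitian[OF _ psd that bit_compl_in_bits] that by (simp add: w_def)
  qed (use n D_nonneg minor in auto)
  hence scaled: "psd ?S (\<lambda>i j. of_real (2 ^ (n - 1) - 1) *
      (if i = j then of_real (D i) else if j = bit_compl ?S i then w i else 0))"
    by (rule psd_scale[rotated]) simp
  have diag: "(\<Sum>A\<in>P. \<tau> (flip A i) (flip A i)) = of_real (D i)" if i: "i \<in> bits ?S" for i
  proof -
    have "\<tau> (flip A i) (flip A i) = of_real (Re (\<tau> (flip A i) (flip A i)))" if "A \<in> P" for A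
      using nonneg[OF PS[OF that] i] by (simp add: complex_nonneg_Reals_iff complex_eq_iff)
    thus ?thesis unfolding D_def of_real_sum by (intro sum.cong) auto
  qed
  show ?thesis
    by (rule iffD2[OF psd_cong scaled])
      (use n P diag in \<open>simp add: op_eq_def eta_X_proj_eq w_def\<close>)
qed

theorem theorem3:
  fixes n :: nat and P :: "nat set set" and \<rho> :: "nat qop"
  assumes "n \<ge> 2"
    and "bipartition_choice {1..n} P"
    and "biseparable {1..n} \<rho>"
  shows "psd {1..n} ((eta n P \<circ> X_proj n) \<rho>)"
proof -
  let ?S = "{1..n}"
  have n: "n \<ge> 1" using assms(1) by simp
  obtain m :: nat and p :: "nat \<Rightarrow> real" and \<tau> where p: "\<forall>k<m. p k \<ge> 0"
    and \<tau>: "\<forall>k<m. is_state ?S (\<tau> k) \<and> biproduct_state ?S (\<tau> k)"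
    and eq: "op_eq ?S \<rho> (\<lambda>i j. \<Sum>k<m. of_real (p k) * \<tau> k i j)"
    using assms(3) unfolding biseparable_def by blast
  have PS: "A \<subseteq> ?S" if "A \<in> P" for A
    using assms(2) that by (auto simp: bipartition_choice_def)
  have "psd ?S (\<lambda>i j. \<Sum>k<m. of_real (p k) * eta n P (X_proj n (\<tau> k)) i j)"
    using p \<tau> by (intro psd_sum psd_scale psd_eta_X_proj_biproduct n assms(2)) auto
  moreover have "op_eq ?S ((eta n P \<circ> X_proj n) \<rho>)
      (\<lambda>i j. \<Sum>k<m. of_real (p k) * eta n P (X_proj n (\<tau> k)) i j)"
    unfolding op_eq_def
  proof (intro ballI)
    fix i j assume i: "i \<in> bits ?S" and j: "j \<in> bits ?S"
    \<comment> \<open>The decomposition is known only at indices in \<open>bits ?S\<close>, so it is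
      applied after the entry formula, where flipped indices stay in \<open>bits ?S\<close>. That
      formula also shows linearity.\<close>
    have \<rho>: "\<rho> a b = (\<Sum>k<m. of_real (p k) * \<tau> k a b)" if "a \<in> bits ?S" "b \<in> bits ?S" for a b
      using eq that by (simp add: op_eq_def)
    have "(\<Sum>A\<in>P. \<rho> (flip A i) (flip A i)) =
        (\<Sum>A\<in>P. \<Sum>k<m. of_real (p k) * \<tau> k (flip A i) (flip A i))"
      using PS i by (intro sum.cong refl \<rho> flip_in_bits)
    also have "\<dots> = (\<Sum>k<m. \<Sum>A\<in>P. of_real (p k) * \<tau> k (flip A i) (flip A i))"
      by (rule sum.swap)
    finally have diag: "(\<Sum>A\<in>P. \<rho> (flip A i) (flip A i)) =
        (\<Sum>k<m. \<Sum>A\<in>P. of_real (p k) * \<tau> k (flip A i) (flip A i))" .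
    show "(eta n P \<circ> X_proj n) \<rho> i j =
        (\<Sum>k<m. of_real (p k) * eta n P (X_proj n (\<tau> k)) i j)"
      unfolding o_apply eta_X_proj_eq[OF n assms(2) i j] diag \<rho>[OF i j]
      by (simp add: sum_distrib_left mult_ac)
  qed
  ultimately show ?thesis
    by (simp add: psd_cong)
qed

end
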